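(* A group $G$ is isolated if and only if the two following properties are satisfied: (i) $G$ is finitely presented; (ii) $G$ is finitely discriminable.
   Context: For a group $G$, $\mathcal{G}(G)$ denotes the set of normal subgroups of $G$, with the topology induced by the product topology on $\{0,1\}^G$. For $m\ge 1$, $\mathcal{G}_m=\mathcal{G}(F_m)$ with $F_m$ the free group of rank $m$; a point $N\in\mathcal{G}_m$ represents the $m$-generated group $F_m/N$ with its marking. A group $G$ is isolated if it is finitely generated and, for some $m$ and some normal subgroup $N$ of $F_m$ with $F_m/N\cong G$, the point $N$ is isolated in $\mathcal{G}_m$ (this does not depend on the choice of $m$ and $N$). A group $G$ is finitely discriminable if there exists a finite subset $F\subset G-\{1\}$ such that every non-trivial normal subgroup of $G$ contains at least one element of $F$. *)

theory Defs
  imports "HOL-Algebra.Generated_Groups" "HOL-Analysis.Function_Topology"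
begin

(* Elements of the free group on X are the reduced words over the letters (x, b) with x in X,
   where (x, True) stands for x and (x, False) for its inverse. *)

type_synonym 'x letter = "'x \<times> bool"

fun reduced :: "'x letter list \<Rightarrow> bool" where
  "reduced [] \<longleftrightarrow> True"
| "reduced [a] \<longleftrightarrow> True"
| "reduced (a # b # w) \<longleftrightarrow> \<not> (fst a = fst b \<and> snd a \<noteq> snd b) \<and> reduced (b # w)"

(* Left multiplication of a reduced word by one letter, with at most one cancellation. *)
fun push :: "'x letter \<Rightarrow> 'x letter list \<Rightarrow> 'x letter list" where
  "push a [] = [a]"
| "push a (b # w) = (if fst a = fst b \<and> snd a \<noteq> snd b then w else a # b # w)"

definition free_group :: "'x set \<Rightarrow> 'x letter list monoid" where
  "free_group X = \<lparr>carrier = {w. set w \<subseteq> X \<times> UNIV \<and> reduced w},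
                   monoid.mult = (\<lambda>u v. foldr push u v),
                   one = []\<rparr>"

abbreviation free_group_rank :: "nat \<Rightarrow> nat letter list monoid" where
  "free_group_rank m \<equiv> free_group {..<m}"

lemma push_reduced: "reduced w \<Longrightarrow> reduced (push a w)"
  by (cases w rule: reduced.cases) (auto)

lemma set_push: "set (push a w) \<subseteq> insert a (set w)"
  by (cases w) auto

lemma push_push:
  assumes "reduced w" "fst a = fst b" "snd a \<noteq> snd b"
  shows "push a (push b w) = w"
  using assms by (cases w rule: reduced.cases) (auto simp: prod_eq_iff)

lemma foldr_push_reduced: "reduced w \<Longrightarrow> reduced (foldr push u w)"
  by (induction u) (auto intro: push_reduced)

lemma set_foldr_push: "set (foldr push u w) \<subseteq> set u \<union> set w"
proof (induction u)
  case (Cons a u)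
  then show ?case using set_push[of a "foldr push u w"] by auto
qed simp

lemma foldr_push_push:
  assumes "reduced w"
  shows "foldr push (push a v) w = push a (foldr push v w)"
  using assms by (cases v) (auto simp: push_push foldr_push_reduced)

lemma foldr_push_assoc:
  "reduced w \<Longrightarrow> foldr push (foldr push u v) w = foldr push u (foldr push v w)"
  by (induction u) (auto simp: foldr_push_push)

lemma foldr_push_Nil: "reduced w \<Longrightarrow> foldr push w [] = w"
  by (induction w rule: reduced.induct) auto

lemma foldr_push_inverse:
  "reduced v \<Longrightarrow> foldr push (rev (map (\<lambda>(x, b). (x, \<not> b)) w)) (foldr push w v) = v"
  by (induction w) (auto simp: push_push foldr_push_reduced)

lemma group_free_group: "group (free_group X)"
proof (rule groupI)
  fix u v assume "u \<in> carrier (free_group X)" "v \<in> carrier (free_group X)"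
  then show "u \<otimes>\<^bsub>free_group X\<^esub> v \<in> carrier (free_group X)"
    using set_foldr_push[of u v] by (fastforce simp: free_group_def foldr_push_reduced)
next
  fix w assume "w \<in> carrier (free_group X)"
  then have w: "set w \<subseteq> X \<times> UNIV" "reduced w"
    by (auto simp: free_group_def)
  let ?i = "rev (map (\<lambda>(x, b). (x, \<not> b)) w)"
  have "set (foldr push ?i []) \<subseteq> X \<times> UNIV"
    using set_foldr_push[of ?i "[]"] w(1) by fastforce
  moreover have "foldr push (foldr push ?i []) w = []"
    using foldr_push_inverse[of "[]" w] w by (simp add: foldr_push_assoc foldr_push_Nil)
  ultimately show "\<exists>v\<in>carrier (free_group X).
      v \<otimes>\<^bsub>free_group X\<^esub> w = \<one>\<^bsub>free_group X\<^esub>"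
    by (intro bexI[of _ "foldr push ?i []"]) (auto simp: free_group_def foldr_push_reduced)
qed (auto simp: free_group_def foldr_push_assoc)

definition finitely_generated_group :: "('a, 'b) monoid_scheme \<Rightarrow> bool" where
  "finitely_generated_group G \<longleftrightarrow>
     (\<exists>S. finite S \<and> S \<subseteq> carrier G \<and> generate G S = carrier G)"

definition normal_closure :: "('a, 'b) monoid_scheme \<Rightarrow> 'a set \<Rightarrow> 'a set" where
  "normal_closure G R = (\<lambda>N. N \<lhd> G) hull R"

definition finitely_presented_group :: "('a, 'b) monoid_scheme \<Rightarrow> bool" where
  "finitely_presented_group G \<longleftrightarrow>
     (\<exists>m R. finite R \<and> R \<subseteq> carrier (free_group_rank m) \<and>
        free_group_rank m Mod normal_closure (free_group_rank m) R \<cong> G)"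

definition finitely_discriminable :: "('a, 'b) monoid_scheme \<Rightarrow> bool" where
  "finitely_discriminable G \<longleftrightarrow>
     (\<exists>F. finite F \<and> F \<subseteq> carrier G - {\<one>\<^bsub>G\<^esub>} \<and>
        (\<forall>N. N \<lhd> G \<and> N \<noteq> {\<one>\<^bsub>G\<^esub>} \<longrightarrow> N \<inter> F \<noteq> {}))"

(* A subset of the group is identified with its indicator function in the product of copies of
   the discrete space bool, one for each element of the carrier. *)
definition normal_subgroup_space :: "('a, 'b) monoid_scheme \<Rightarrow> 'a set topology" where
  "normal_subgroup_space G =
     pullback_topology {N. N \<lhd> G} (\<lambda>N. \<lambda>x\<in>carrier G. x \<in> N)
       (product_topology (\<lambda>_. discrete_topology (UNIV :: bool set)) (carrier G))"

definition isolated_group :: "('a, 'b) monoid_scheme \<Rightarrow> bool" where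
  "isolated_group G \<longleftrightarrow>
     finitely_generated_group G \<and>
     (\<exists>m\<ge>1. \<exists>N. N \<lhd> free_group_rank m \<and> free_group_rank m Mod N \<cong> G \<and>
        openin (normal_subgroup_space (free_group_rank m)) {N})"

end

theory Submission
  imports Defs
begin

text \<open>
  Let \<open>h : F \<rightarrow> G\<close> be a surjective homomorphism with kernel \<open>K\<close>. A basic neighbourhood of
  \<open>K\<close> in the space of normal subgroups of \<open>F\<close> prescribes finitely many elements \<open>R\<close> that must
  belong to a normal subgroup and finitely many elements \<open>S\<close> that must not. If \<open>K\<close> is the only
  normal subgroup that meets these requirements, both finiteness conditions appear:

  \<^item> The normal closure of \<open>R\<close> lies in \<open>K\<close>, so it contains \<open>R\<close> and avoids \<open>S\<close>; hence it equals
    \<open>K\<close>, and \<open>K\<close> is finitely generated as a normal subgroup.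
  \<^item> Normal subgroups of \<open>G\<close> pull back to normal subgroups of \<open>F\<close> above \<open>K\<close>, hence above \<open>R\<close>.
    Those other than \<open>K\<close> must meet \<open>S\<close>, so the finite set \<open>h ` S\<close> meets every non-trivial
    normal subgroup of \<open>G\<close>.

  Conversely, if \<open>K\<close> is the normal closure of a finite set \<open>R\<close> and a finite set \<open>D\<close> discriminates
  \<open>G\<close>, let \<open>S\<close> be a finite set of preimages of \<open>D\<close>. A normal subgroup containing \<open>R\<close> contains \<open>K\<close>;
  if it also avoids \<open>S\<close>, its image in \<open>G\<close> avoids \<open>D\<close> and is therefore trivial, so it equals \<open>K\<close>.

  This equivalence, \<open>kernel_isolated_iff\<close>, holds for every group \<open>F\<close>. The theorem is its case of a
  free group of finite rank, where "\<open>K\<close> is the normal closure of a finite set" says that \<open>h\<close> is a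
  finite presentation. There remain the translation between quotients and surjective
  homomorphisms, finite generation of \<open>G\<close>, and the presentations of rank \<open>0\<close>, because isolated
  points are sought in positive rank only.
\<close>

section \<open>Normal subgroups, homomorphisms and quotients\<close>

lemma (in group) normal_normal_closure:
  assumes "R \<subseteq> carrier G"
  shows "normal_closure G R \<lhd> G"
proof -
  let ?\<N> = "{N. N \<lhd> G \<and> R \<subseteq> N}"
  have "?\<N> \<noteq> {}"
    using normal_self assms by blast
  then have "subgroup (\<Inter>?\<N>) G"
    by (intro subgroups_Inter) (auto dest: normal_imp_subgroup)
  then show ?thesis
    unfolding normal_closure_def hull_def normal_inv_iff
    by (auto dest: normal.inv_op_closed2)
qed

lemma normal_closure_superset: "R \<subseteq> normal_closure G R"
  unfolding normal_closure_def by (rule hull_subset)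

lemma normal_closure_minimal: "R \<subseteq> N \<Longrightarrow> N \<lhd> G \<Longrightarrow> normal_closure G R \<subseteq> N"
  unfolding normal_closure_def by (rule hull_minimal)

lemma (in group_hom) normal_vimage:
  assumes "N \<lhd> H"
  shows "{x \<in> carrier G. h x \<in> N} \<lhd> G"
proof -
  interpret N: normal N H by fact
  show ?thesis
    unfolding G.normal_inv_iff
    by (auto intro!: G.subgroupI N.inv_op_closed2 exI[of _ "\<one>\<^bsub>G\<^esub>"])
qed

text \<open>
  Working with a surjective homomorphism instead of an isomorphism from the quotient avoids all
  computation with cosets afterwards: normal subgroups are moved by direct and inverse images.
\<close>

lemma (in normal) FactGroup_iso_iff_epimorphism:
  assumes "group K"
  shows "G Mod H \<cong> K \<longleftrightarrow>
    (\<exists>h. group_hom G K h \<and> h ` carrier G = carrier K \<and> kernel G K h = H)"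
proof
  assume "G Mod H \<cong> K"
  then obtain f where f: "f \<in> iso (G Mod H) K"
    by (auto simp: is_iso_def)
  let ?h = "\<lambda>x. f (H #> x)"
  have inj: "inj_on f (carrier (G Mod H))" and surj: "f ` carrier (G Mod H) = carrier K"
    and f_hom: "f \<in> hom (G Mod H) K"
    using f by (auto simp: iso_def bij_betw_def)
  have "f \<circ> (\<lambda>x. H #> x) \<in> hom G K"
    by (rule Group.hom_compose[OF r_coset_hom_Mod f_hom])
  then have hom: "group_hom G K ?h"
    using assms by (simp add: group_hom_def group_hom_axioms_def comp_def)
  have "?h ` carrier G = carrier K"
    using surj by (simp add: carrier_FactGroup image_image)
  moreover have "kernel G K ?h = H"
  proof -
    have f_one: "f H = \<one>\<^bsub>K\<^esub>"
      using hom_one[OF f_hom factorgroup_is_group assms] by simp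
    have H_mem: "H \<in> carrier (G Mod H)"
      using coset_mult_one[OF subset] by (auto simp: carrier_FactGroup image_iff intro!: bexI[of _ \<one>])
    have "f (H #> x) = \<one>\<^bsub>K\<^esub> \<longleftrightarrow> x \<in> H" if "x \<in> carrier G" for x
    proof -
      have "H #> x \<in> carrier (G Mod H)"
        using that by (simp add: carrier_FactGroup)
      then have "f (H #> x) = \<one>\<^bsub>K\<^esub> \<longleftrightarrow> H #> x = H"
        using inj_on_eq_iff[OF inj _ H_mem] f_one by simp
      also have "\<dots> \<longleftrightarrow> x \<in> H"
        using coset_join1[OF _ that subgroup_axioms] coset_join2[OF that subgroup_axioms] by blast
      finally show ?thesis .
    qed
    then show ?thesis
      using subset by (auto simp: kernel_def)
  qed
  ultimately show "\<exists>h. group_hom G K h \<and> h ` carrier G = carrier K \<and> kernel G K h = H"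
    using hom by blast
next
  assume "\<exists>h. group_hom G K h \<and> h ` carrier G = carrier K \<and> kernel G K h = H"
  then obtain h where "group_hom G K h" "h ` carrier G = carrier K" "kernel G K h = H"
    by (elim exE conjE) (rule that)
  then show "G Mod H \<cong> K"
    using group_hom.FactGroup_iso[of G K h] by simp
qed

section \<open>Isolated points of the space of normal subgroups\<close>

text \<open>
  An open box of the product space constrains only finitely many coordinates, and a non-trivial
  constraint on a coordinate \<open>x\<close> that is satisfied by \<open>N\<close> fixes whether \<open>x\<close> is a member.
\<close>

lemma (in group) openin_singleton_normal_subgroup_space_iff:
  assumes "N \<lhd> G"
  shows "openin (normal_subgroup_space G) {N} \<longleftrightarrow>
    (\<exists>R S. finite R \<and> R \<subseteq> N \<and> finite S \<and> S \<subseteq> carrier G - N \<and>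
       (\<forall>M. M \<lhd> G \<and> R \<subseteq> M \<and> S \<inter> M = {} \<longrightarrow> M = N))"
proof -
  let ?\<chi> = "\<lambda>N. \<lambda>x\<in>carrier G. x \<in> N"
  let ?X = "product_topology (\<lambda>_. discrete_topology (UNIV :: bool set)) (carrier G)"
  show ?thesis
  proof
    assume "openin (normal_subgroup_space G) {N}"
    then obtain V where V: "openin ?X V" "{N} = ?\<chi> -` V \<inter> {M. M \<lhd> G}"
      unfolding normal_subgroup_space_def openin_pullback_topology by blast
    then have "?\<chi> N \<in> V" by blast
    then obtain U where U: "finite {x \<in> carrier G. U x \<noteq> (UNIV :: bool set)}"
      "?\<chi> N \<in> PiE (carrier G) U" "PiE (carrier G) U \<subseteq> V"
      using V(1) unfolding openin_product_topology_alt by force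
    let ?D = "{x \<in> carrier G. U x \<noteq> UNIV}"
    have "M = N" if M: "M \<lhd> G" "?D \<inter> N \<subseteq> M" "(?D - N) \<inter> M = {}" for M
    proof -
      have "?\<chi> M \<in> PiE (carrier G) U"
      proof (rule PiE_I)
        fix x assume x: "x \<in> carrier G"
        have NU: "(x \<in> N) \<in> U x"
          using PiE_mem[OF U(2) x] x by simp
        show "?\<chi> M x \<in> U x"
        proof (cases "x \<in> ?D")
          case True
          then have "x \<in> M \<longleftrightarrow> x \<in> N"
            using M by blast
          then show ?thesis using NU x by simp
        qed (use x in auto)
      qed auto
      then have "M \<in> ?\<chi> -` V \<inter> {M. M \<lhd> G}"
        using U(3) M(1) by blast
      then show ?thesis using V(2) by blast
    qed
    then show "\<exists>R S. finite R \<and> R \<subseteq> N \<and> finite S \<and> S \<subseteq> carrier G - N \<and>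
       (\<forall>M. M \<lhd> G \<and> R \<subseteq> M \<and> S \<inter> M = {} \<longrightarrow> M = N)"
      using U(1)
      by (intro exI[of _ "?D \<inter> N"] exI[of _ "?D - N"]) auto
  next
    assume "\<exists>R S. finite R \<and> R \<subseteq> N \<and> finite S \<and> S \<subseteq> carrier G - N \<and>
       (\<forall>M. M \<lhd> G \<and> R \<subseteq> M \<and> S \<inter> M = {} \<longrightarrow> M = N)"
    then obtain R S where RS: "finite R" "R \<subseteq> N" "finite S" "S \<subseteq> carrier G - N"
      and unique: "\<forall>M. M \<lhd> G \<and> R \<subseteq> M \<and> S \<inter> M = {} \<longrightarrow> M = N"
      by (elim exE conjE) (rule that)
    have NG: "N \<subseteq> carrier G"
      using assms by (simp add: normal_imp_subgroup subgroup.subset)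
    define U where "U x = (if x \<in> R then {True} else if x \<in> S then {False} else UNIV)" for x
    let ?V = "PiE (carrier G) U"
    have "{x \<in> carrier G. U x \<noteq> UNIV} \<subseteq> R \<union> S"
      by (auto simp: U_def)
    then have "finite {x \<in> carrier G. U x \<noteq> UNIV}"
      using RS(1,3) finite_subset by blast
    then have "openin ?X ?V"
      by (simp add: openin_PiE_gen)
    moreover have "M = N" if "M \<lhd> G" "?\<chi> M \<in> ?V" for M
    proof (rule unique[rule_format, OF conjI[OF that(1) conjI]])
      have mem: "(x \<in> M) \<in> U x" if "x \<in> carrier G" for x
        using PiE_mem[OF \<open>?\<chi> M \<in> ?V\<close> that] that by simp
      show "R \<subseteq> M"
      proof
        fix x assume "x \<in> R"
        then show "x \<in> M" using mem[of x] RS(2) NG by (auto simp: U_def)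
      qed
      show "S \<inter> M = {}"
      proof -
        have "x \<notin> M" if "x \<in> S" for x
        proof -
          have "x \<in> carrier G" "x \<notin> R"
            using that RS(2,4) by blast+
          then show ?thesis
            using mem[of x] that by (simp add: U_def)
        qed
        then show ?thesis by blast
      qed
    qed
    moreover have "?\<chi> N \<in> ?V"
      using RS(2,4) by (auto simp: U_def)
    ultimately have "{N} = ?\<chi> -` ?V \<inter> {M. M \<lhd> G}"
      using assms by blast
    with \<open>openin ?X ?V\<close> show "openin (normal_subgroup_space G) {N}"
      unfolding normal_subgroup_space_def openin_pullback_topology by blast
  qed
qed

text \<open>
  The correspondence between normal subgroups of the image and normal subgroups above the kernel
  turns the elements required to lie in the kernel into normal generators, and the elements
  required to lie outside it into a discriminating set.
\<close>

theorem (in group_hom) kernel_isolated_iff: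
  assumes surj: "h ` carrier G = carrier H"
  shows "openin (normal_subgroup_space G) {kernel G H h} \<longleftrightarrow>
    (\<exists>R. finite R \<and> R \<subseteq> carrier G \<and> normal_closure G R = kernel G H h) \<and>
    finitely_discriminable H"
proof -
  let ?K = "kernel G H h"
  have KG: "?K \<subseteq> carrier G" by (auto simp: kernel_def)
  have isolated_imp:
    "(\<exists>R. finite R \<and> R \<subseteq> carrier G \<and> normal_closure G R = ?K) \<and> finitely_discriminable H"
    if "finite R" "R \<subseteq> ?K" "finite S" "S \<subseteq> carrier G - ?K"
      and unique: "\<forall>M. M \<lhd> G \<and> R \<subseteq> M \<and> S \<inter> M = {} \<longrightarrow> M = ?K" for R S
  proof
    have isolated: "M = ?K" if "M \<lhd> G" "R \<subseteq> M" "S \<inter> M = {}" for M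
      using unique that by simp
    have "normal_closure G R = ?K"
    proof (rule isolated)
      show "normal_closure G R \<lhd> G"
        using that(2) KG by (intro G.normal_normal_closure) auto
      show "R \<subseteq> normal_closure G R"
        by (rule normal_closure_superset)
      have "normal_closure G R \<subseteq> ?K"
        by (rule normal_closure_minimal[OF that(2) normal_kernel])
      then show "S \<inter> normal_closure G R = {}"
        using that(4) by blast
    qed
    then show "\<exists>R. finite R \<and> R \<subseteq> carrier G \<and> normal_closure G R = ?K"
      using that(1,2) KG by blast
    have "M \<inter> h ` S \<noteq> {}" if M: "M \<lhd> H" "M \<noteq> {\<one>\<^bsub>H\<^esub>}" for M
    proof
      assume disj: "M \<inter> h ` S = {}"
      interpret M: normal M H by fact
      have "{x \<in> carrier G. h x \<in> M} = ?K"
      proof (rule isolated)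
        show "{x \<in> carrier G. h x \<in> M} \<lhd> G"
          using M(1) by (rule normal_vimage)
        show "R \<subseteq> {x \<in> carrier G. h x \<in> M}"
          using \<open>R \<subseteq> ?K\<close> by (auto simp: kernel_def)
        show "S \<inter> {x \<in> carrier G. h x \<in> M} = {}"
          using disj by blast
      qed
      then have "h ` {x \<in> carrier G. h x \<in> M} \<subseteq> {\<one>\<^bsub>H\<^esub>}"
        by (auto simp: kernel_def)
      moreover have "h ` {x \<in> carrier G. h x \<in> M} = M"
        using M.subset surj by auto
      ultimately show False
        using M(2) M.one_closed by blast
    qed
    moreover have "h ` S \<subseteq> carrier H - {\<one>\<^bsub>H\<^esub>}"
      using that(4) by (auto simp: kernel_def)
    ultimately show "finitely_discriminable H"
      unfolding finitely_discriminable_def using \<open>finite S\<close> by blast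
  qed
  have imp_isolated: "\<exists>R S. finite R \<and> R \<subseteq> ?K \<and> finite S \<and> S \<subseteq> carrier G - ?K \<and>
       (\<forall>M. M \<lhd> G \<and> R \<subseteq> M \<and> S \<inter> M = {} \<longrightarrow> M = ?K)"
    if R: "finite R" "R \<subseteq> carrier G" "normal_closure G R = ?K"
      and disc: "finitely_discriminable H" for R
  proof -
    obtain D where D: "finite D" "D \<subseteq> carrier H - {\<one>\<^bsub>H\<^esub>}"
      "\<And>M. M \<lhd> H \<Longrightarrow> M \<noteq> {\<one>\<^bsub>H\<^esub>} \<Longrightarrow> M \<inter> D \<noteq> {}"
      using disc unfolding finitely_discriminable_def by blast
    have "D \<subseteq> h ` carrier G"
      using D(2) surj by blast
    then obtain S where S: "S \<subseteq> carrier G" "finite S" "D = h ` S"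
      using finite_subset_image[OF D(1)] by metis
    have "M = ?K" if M: "M \<lhd> G" "R \<subseteq> M" "S \<inter> M = {}" for M
    proof
      interpret M: normal M G by fact
      show KM: "?K \<subseteq> M"
        using normal_closure_minimal[OF M(2,1)] R(3) by simp
      \<comment> \<open>Since \<open>M\<close> contains the kernel, it is saturated: membership of \<open>x\<close> in \<open>M\<close>
        depends only on \<open>h x\<close>.\<close>
      have sat: "x \<in> M" if "x \<in> carrier G" "y \<in> M" "h x = h y" for x y
      proof -
        have y: "y \<in> carrier G" using that(2) M.subset by blast
        have "x \<otimes>\<^bsub>G\<^esub> inv\<^bsub>G\<^esub> y \<in> ?K"
          using that y by (simp add: kernel_def)
        then have "(x \<otimes>\<^bsub>G\<^esub> inv\<^bsub>G\<^esub> y) \<otimes>\<^bsub>G\<^esub> y \<in> M"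
          using KM that(2) by blast
        then show ?thesis
          using that(1) y by (simp add: G.m_assoc)
      qed
      have "h ` M \<inter> D = {}"
      proof -
        have False if "s \<in> S" "y \<in> M" "h s = h y" for s y
          using sat[of s y] that S(1) M(3) by blast
        then show ?thesis using S(3) by fastforce
      qed
      moreover have "h ` M \<lhd> H"
        using M.surj_hom_normal_subgroup[OF group_hom_axioms surj] .
      ultimately have "h ` M = {\<one>\<^bsub>H\<^esub>}"
        using D(3) by blast
      then show "M \<subseteq> ?K"
        using M.subset by (auto simp: kernel_def)
    qed
    moreover have "S \<subseteq> carrier G - ?K"
      using S D(2) by (auto simp: kernel_def)
    moreover have "R \<subseteq> ?K"
      using normal_closure_superset[of R G] R(3) by simp
    ultimately show ?thesis
      using R(1) S(2) by blast
  qed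
  show ?thesis
    unfolding G.openin_singleton_normal_subgroup_space_iff[OF normal_kernel]
    by (rule iffI; elim exE conjE; (rule isolated_imp; assumption | rule imp_isolated; assumption))
qed

section \<open>Generators of free groups\<close>

lemma generate_free_group:
  "generate (free_group X) ((\<lambda>x. [(x, True)]) ` X) = carrier (free_group X)"
proof
  interpret group "free_group X" by (rule group_free_group)
  let ?B = "(\<lambda>x. [(x, True)]) ` X"
  have B: "?B \<subseteq> carrier (free_group X)"
    by (auto simp: free_group_def)
  interpret gen: subgroup "generate (free_group X) ?B" "free_group X"
    using B by (rule generate_is_subgroup)
  show "generate (free_group X) ?B \<subseteq> carrier (free_group X)"
    by (rule gen.subset)
  have letter: "[(x, b)] \<in> generate (free_group X) ?B" if "x \<in> X" for x b
  proof (cases b)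
    case True
    then show ?thesis using that by (auto intro: generate.incl)
  next
    case False
    have "inv\<^bsub>free_group X\<^esub> [(x, True)] = [(x, False)]"
      using that by (intro inv_equality) (auto simp: free_group_def)
    then show ?thesis
      using False generate.inv[of "[(x, True)]" ?B "free_group X"] that by auto
  qed
  have "w \<in> generate (free_group X) ?B" if "set w \<subseteq> X \<times> UNIV" "reduced w" for w
    using that
  proof (induction w)
    case Nil
    then show ?case
      using gen.one_closed by (simp add: free_group_def)
  next
    case (Cons a w)
    have "reduced w" "push a w = a # w"
      using Cons.prems(2) by (cases w; auto)+
    moreover have "[a] \<in> generate (free_group X) ?B"
      using letter[of "fst a" "snd a"] Cons.prems(1) by auto
    ultimately have "[a] \<otimes>\<^bsub>free_group X\<^esub> w \<in> generate (free_group X) ?B"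
      using Cons by auto
    then show ?case
      using \<open>push a w = a # w\<close> by (simp add: free_group_def)
  qed
  then show "carrier (free_group X) \<subseteq> generate (free_group X) ?B"
    by (auto simp: free_group_def)
qed

lemma (in group_hom) finitely_generated_group_image:
  assumes "finitely_generated_group G" "h ` carrier G = carrier H"
  shows "finitely_generated_group H"
proof -
  obtain S where S: "finite S" "S \<subseteq> carrier G" "generate G S = carrier G"
    using assms(1) by (auto simp: finitely_generated_group_def)
  have "generate H (h ` S) = carrier H"
    using generate_img[OF S(2)] S(3) assms(2) by simp
  moreover have "h ` S \<subseteq> carrier H"
    using S(2) assms(2) by blast
  ultimately show ?thesis
    using S(1) unfolding finitely_generated_group_def by blast
qed

lemma finitely_generated_free_group:
  "finite X \<Longrightarrow> finitely_generated_group (free_group X)"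
  unfolding finitely_generated_group_def
  by (intro exI[of _ "(\<lambda>x. [(x, True)]) ` X"])
    (auto simp: generate_free_group, auto simp: free_group_def)

section \<open>Finite presentations\<close>

lemma finitely_presented_group_iff_epimorphism:
  assumes "group G"
  shows "finitely_presented_group G \<longleftrightarrow>
    (\<exists>m h R. group_hom (free_group_rank m) G h \<and> h ` carrier (free_group_rank m) = carrier G \<and>
       finite R \<and> R \<subseteq> carrier (free_group_rank m) \<and>
       normal_closure (free_group_rank m) R = kernel (free_group_rank m) G h)"
proof -
  have "free_group_rank m Mod normal_closure (free_group_rank m) R \<cong> G \<longleftrightarrow>
      (\<exists>h. group_hom (free_group_rank m) G h \<and> h ` carrier (free_group_rank m) = carrier G \<and>
         kernel (free_group_rank m) G h = normal_closure (free_group_rank m) R)"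
    if "R \<subseteq> carrier (free_group_rank m)" for m R
    using normal.FactGroup_iso_iff_epimorphism[OF group.normal_normal_closure assms]
      group_free_group that by blast
  then show ?thesis
    unfolding finitely_presented_group_def by metis
qed

text \<open>
  A presentation of rank \<open>0\<close> presents the trivial group, which is also presented by one generator
  that is killed by one relator.
\<close>

lemma finitely_presented_positive_rank:
  assumes "group G" "finitely_presented_group G"
  obtains m h R where "m \<ge> 1" "group_hom (free_group_rank m) G h"
    "h ` carrier (free_group_rank m) = carrier G"
    "finite R" "R \<subseteq> carrier (free_group_rank m)"
    "normal_closure (free_group_rank m) R = kernel (free_group_rank m) G h"
proof -
  obtain m h R where mhR: "group_hom (free_group_rank m) G h"
    "h ` carrier (free_group_rank m) = carrier G"
    "finite R" "R \<subseteq> carrier (free_group_rank m)"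
    "normal_closure (free_group_rank m) R = kernel (free_group_rank m) G h"
    using assms(2) unfolding finitely_presented_group_iff_epimorphism[OF assms(1)] by blast
  show ?thesis
  proof (cases "m = 0")
    case False
    then show ?thesis using that[of m h R] mhR by simp
  next
    case True
    interpret h: group_hom "free_group_rank m" G h by fact
    have "carrier (free_group_rank m) = {\<one>\<^bsub>free_group_rank m\<^esub>}"
      using True by (auto simp: free_group_def)
    then have triv: "carrier G = {\<one>\<^bsub>G\<^esub>}"
      using mhR(2) h.hom_one by (metis image_empty image_insert)
    let ?F = "free_group_rank 1" and ?c = "\<lambda>_. \<one>\<^bsub>G\<^esub>"
    interpret F: group ?F by (rule group_free_group)
    have ker: "kernel ?F G ?c = carrier ?F"
      by (auto simp: kernel_def)
    let ?R = "(\<lambda>x. [(x, True)]) ` {..<1::nat}"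
    have R: "?R \<subseteq> carrier ?F"
      by (auto simp: free_group_def)
    have normal: "normal_closure ?F ?R \<lhd> ?F"
      by (rule F.normal_normal_closure[OF R])
    have "generate ?F ?R \<subseteq> normal_closure ?F ?R"
      by (rule F.generate_subgroup_incl[OF normal_closure_superset normal_imp_subgroup[OF normal]])
    then have "normal_closure ?F ?R = carrier ?F"
      using normal normal_imp_subgroup subgroup.subset
      by (fastforce simp: generate_free_group)
    then have "normal_closure ?F ?R = kernel ?F G ?c"
      using ker by simp
    moreover have "group_hom ?F G ?c"
      using assms(1) F.is_group triv
      by (auto simp: group_hom_def group_hom_axioms_def hom_def group.is_monoid)
    moreover have "?c ` carrier ?F = carrier G"
      using triv F.one_closed by blast
    ultimately show ?thesis
      using that[of 1 ?c ?R] R by blast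
  qed
qed

theorem proposition2:
  fixes G :: "('a, 'b) monoid_scheme"
  assumes "group G"
  shows "isolated_group G \<longleftrightarrow> finitely_presented_group G \<and> finitely_discriminable G"
proof
  assume "isolated_group G"
  then obtain m N where N: "N \<lhd> free_group_rank m" "free_group_rank m Mod N \<cong> G"
    "openin (normal_subgroup_space (free_group_rank m)) {N}"
    unfolding isolated_group_def by blast
  then obtain h where h: "group_hom (free_group_rank m) G h"
    "h ` carrier (free_group_rank m) = carrier G" "kernel (free_group_rank m) G h = N"
    using normal.FactGroup_iso_iff_epimorphism[OF N(1) assms] by blast
  then show "finitely_presented_group G \<and> finitely_discriminable G"
    using group_hom.kernel_isolated_iff[OF h(1,2)] N(3)
    unfolding finitely_presented_group_iff_epimorphism[OF assms] by blast
next
  assume G: "finitely_presented_group G \<and> finitely_discriminable G"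
  then obtain m h R where mhR: "m \<ge> 1" "group_hom (free_group_rank m) G h"
    "h ` carrier (free_group_rank m) = carrier G"
    "finite R" "R \<subseteq> carrier (free_group_rank m)"
    "normal_closure (free_group_rank m) R = kernel (free_group_rank m) G h"
    using finitely_presented_positive_rank[OF assms] by metis
  let ?N = "kernel (free_group_rank m) G h"
  have "openin (normal_subgroup_space (free_group_rank m)) {?N}"
    using group_hom.kernel_isolated_iff[OF mhR(2,3)] mhR(4-6) G by blast
  moreover have "?N \<lhd> free_group_rank m"
    by (rule group_hom.normal_kernel[OF mhR(2)])
  moreover have "free_group_rank m Mod ?N \<cong> G"
    by (rule group_hom.FactGroup_iso[OF mhR(2,3)])
  moreover have "finitely_generated_group G"
    by (rule group_hom.finitely_generated_group_image
        [OF mhR(2) finitely_generated_free_group[OF finite_lessThan] mhR(3)])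
  ultimately show "isolated_group G"
    unfolding isolated_group_def using mhR(1) by blast
qed

end
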